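(* Let $X$ be a complete separable metric space and let $\{E_\sigma : \sigma\in\Sigma_*\}$ be a Moran construction on $X$, that is, a collection of nonempty compact subsets of a set $E_\varnothing\subset X$ such that (M1) $E_\sigma\subset E_{\sigma^-}$ for all $\sigma\in\Sigma_*$, and (M2) $\operatorname{diam}(E_{\sigma|_n})\to 0$ as $n\to\infty$ for all $\sigma\in\Sigma$. Suppose that the Moran construction satisfies the finite clustering property, i.e. $\sup_{x\in E}\limsup_{r\downarrow 0}\# N(x,r)<\infty$. If $\mu$ is a finite Borel regular measure on $\Sigma$, then for $\mu$-almost all $\sigma\in\Sigma$, $$\underline{\dim}_{\mathrm{loc}}(\pi\mu,\pi(\sigma))=\liminf_{n\to\infty}\frac{\log\mu([\sigma|_n])}{\log\operatorname{diam}(E_{\sigma|_n})}$$ and $$\overline{\dim}_{\mathrm{loc}}(\pi\mu,\pi(\sigma))\ge\limsup_{n\to\infty}\frac{\log\mu([\sigma|_n])}{\log\operatorname{diam}(E_{\sigma|_n})}.$$ Furthermore, if the Moran construction also satisfies (M5) $$\lim_{n\to\infty}\frac{\log\operatorname{diam}(E_{\sigma|_n})}{\log\min\{\operatorname{diam}(E_\omega):\omega\in\Sigma_{n+1}\text{ such that }\omega^-=\sigma|_n\}}=1,$$ where the convergence is uniform over all $\sigma\in\Sigma$, then for $\mu$-almost all $\sigma\in\Sigma$ the last inequality (for the upper local dimension) holds with equality.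
   Context: Symbolic notation. For each $j\in\mathbb{N}=\{1,2,\dots\}$ a nonempty finite set $I_j$ is fixed, and $\Sigma=\prod_{j=1}^\infty I_j$ carries the product of the discrete topologies (so $\Sigma$ is compact). For $\sigma=i_1i_2\cdots\in\Sigma$ let $\sigma|_n=i_1\cdots i_n$; $\Sigma_n=\{\sigma|_n:\sigma\in\Sigma\}$; $\Sigma_*=\bigcup_{n=1}^\infty\Sigma_n$. For $\sigma\in\Sigma_*$, $|\sigma|$ is its length, $\sigma^-=\sigma|_{|\sigma|-1}$ is $\sigma$ with its last symbol removed (with $\sigma|_0=\varnothing$, the empty word, so for $|\sigma|=1$ the set $E_{\sigma^-}$ is $E_\varnothing$), and $[\sigma]=\{\omega\in\Sigma:\omega|_{|\sigma|}=\sigma\}$. Limit set and projection. The limit set of the Moran construction is the compact set $E=\bigcap_{n\in\mathbb{N}}\bigcup_{\sigma\in\Sigma_n}E_\sigma$. For $\sigma\in\Sigma$, $\pi(\sigma)$ denotes the single point of $\bigcap_{n\in\mathbb{N}}E_{\sigma|_n}$; the map $\pi\colon\Sigma\to E$ is a continuous surjection. $\pi\mu$ is the pushforward measure, $\pi\mu(B)=\mu(\pi^{-1}(B))$. The construction sets may be placed arbitrarily and need not be disjoint. Finite clustering. For $x\in E$ and $r>0$, $$N(x,r)=\{\sigma\in\Sigma_*:\operatorname{diam}(E_\sigma)\le r<\operatorname{diam}(E_{\sigma^-})\text{ and }E_\sigma\cap B(x,r)\neq\emptyset\},$$ where $B(x,r)$ is the closed ball of radius $r$ centered at $x$, and $\#$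 denotes cardinality. Local dimensions. For a locally finite Borel regular measure $\nu$ on $X$ and $x\in X$, $$\underline{\dim}_{\mathrm{loc}}(\nu,x)=\liminf_{r\downarrow0}\frac{\log\nu(B(x,r))}{\log r},\qquad \overline{\dim}_{\mathrm{loc}}(\nu,x)=\limsup_{r\downarrow0}\frac{\log\nu(B(x,r))}{\log r}.$$ Conventions: $\log 0=-\infty$, and $c/(-\infty)=0$ for $c\in\mathbb{R}$. *)

theory Defs
  imports "HOL-Analysis.Analysis"
begin

section \<open>Extended-valued diameter and logarithm\<close>

text \<open>
  The library's \<^const>\<open>diameter\<close> has no meaningful value on unbounded sets. All construction
  sets are compact, but the ambient set \<open>E\<^sub>\<emptyset>\<close> may be unbounded.
\<close>

definition ediam :: "'a::metric_space set \<Rightarrow> ennreal" where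
  "ediam S = (if bounded S then ennreal (diameter S) else top)"

text \<open>
  \<open>log 0 = -\<infinity>\<close>. Division on \<^typ>\<open>ereal\<close> satisfies \<open>c / (-\<infinity>) = 0\<close> for every \<open>c\<close>;
  in particular the undefined quotient \<open>(-\<infinity>) / (-\<infinity>)\<close> is also \<open>0\<close>.
\<close>

definition elog :: "ennreal \<Rightarrow> ereal" where
  "elog x = (if x = 0 then -\<infinity> else if x = top then \<infinity> else ereal (ln (enn2real x)))"


section \<open>Symbolic space\<close>

text \<open>
  Sequences are indexed from \<open>0\<close>: the symbol \<open>i\<^sub>j \<in> I\<^sub>j\<close> (\<open>j = 1, 2, \<dots>\<close>) of \<open>\<sigma>\<close> is \<open>\<sigma> (j - 1)\<close>,
  and \<open>I\<^sub>j\<close> is \<open>I (j - 1)\<close>. Finite words are lists, \<open>\<emptyset>\<close> is \<^term>\<open>[]\<close>, and \<open>\<sigma>\<^sup>-\<close> is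
  \<^term>\<open>butlast \<sigma>\<close>.
\<close>

definition seqs :: "(nat \<Rightarrow> 'i set) \<Rightarrow> (nat \<Rightarrow> 'i) set" where
  "seqs I = (\<Pi>\<^sub>E j\<in>UNIV. I j)"

definition seqs_topology :: "(nat \<Rightarrow> 'i set) \<Rightarrow> (nat \<Rightarrow> 'i) topology" where
  "seqs_topology I = product_topology (\<lambda>j. discrete_topology (I j)) UNIV"

definition trunc :: "(nat \<Rightarrow> 'i) \<Rightarrow> nat \<Rightarrow> 'i list" where
  "trunc \<sigma> n = map \<sigma> [0..<n]"

definition words_of_length :: "(nat \<Rightarrow> 'i set) \<Rightarrow> nat \<Rightarrow> 'i list set" where
  "words_of_length I n = (\<lambda>\<sigma>. trunc \<sigma> n) ` seqs I"

definition words :: "(nat \<Rightarrow> 'i set) \<Rightarrow> 'i list set" where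
  "words I = (\<Union>n\<in>{1..}. words_of_length I n)"

definition cylinder :: "(nat \<Rightarrow> 'i set) \<Rightarrow> 'i list \<Rightarrow> (nat \<Rightarrow> 'i) set" where
  "cylinder I w = {\<omega> \<in> seqs I. trunc \<omega> (length w) = w}"


section \<open>Moran constructions\<close>

text \<open>\<^term>\<open>E []\<close> is the ambient set \<open>E\<^sub>\<emptyset>\<close>, on which nothing is imposed.\<close>

definition moran_construction ::
    "(nat \<Rightarrow> 'i set) \<Rightarrow> ('i list \<Rightarrow> 'a::metric_space set) \<Rightarrow> bool" where
  "moran_construction I E \<longleftrightarrow>
     (\<forall>j. finite (I j) \<and> I j \<noteq> {}) \<and>
     (\<forall>w\<in>words I. E w \<noteq> {} \<and> compact (E w) \<and> E w \<subseteq> E []) \<and>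
     (\<forall>w\<in>words I. E w \<subseteq> E (butlast w)) \<and>
     (\<forall>\<sigma>\<in>seqs I. (\<lambda>n. ediam (E (trunc \<sigma> n))) \<longlonglongrightarrow> 0)"

definition limit_set ::
    "(nat \<Rightarrow> 'i set) \<Rightarrow> ('i list \<Rightarrow> 'a set) \<Rightarrow> 'a set" where
  "limit_set I E = (\<Inter>n\<in>{1..}. \<Union>w\<in>words_of_length I n. E w)"

definition code_map :: "('i list \<Rightarrow> 'a set) \<Rightarrow> (nat \<Rightarrow> 'i) \<Rightarrow> 'a" where
  "code_map E \<sigma> = (THE x. x \<in> (\<Inter>n\<in>{1..}. E (trunc \<sigma> n)))"

definition cluster ::
    "(nat \<Rightarrow> 'i set) \<Rightarrow> ('i list \<Rightarrow> 'a::metric_space set) \<Rightarrow> 'a \<Rightarrow> real \<Rightarrow> 'i list set" where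
  "cluster I E x r =
     {w \<in> words I. ediam (E w) \<le> ennreal r \<and> ennreal r < ediam (E (butlast w)) \<and>
        E w \<inter> cball x r \<noteq> {}}"

text \<open>The counting measure gives the cardinality as an extended number.\<close>

definition finite_clustering ::
    "(nat \<Rightarrow> 'i set) \<Rightarrow> ('i list \<Rightarrow> 'a::metric_space set) \<Rightarrow> bool" where
  "finite_clustering I E \<longleftrightarrow>
     (SUP x\<in>limit_set I E.
        Limsup (at_right 0) (\<lambda>r. emeasure (count_space UNIV) (cluster I E x r))) < \<infinity>"

definition min_child_diam ::
    "(nat \<Rightarrow> 'i set) \<Rightarrow> ('i list \<Rightarrow> 'a::metric_space set) \<Rightarrow> (nat \<Rightarrow> 'i) \<Rightarrow> nat \<Rightarrow> ennreal" where
  "min_child_diam I E \<sigma> n =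
     Min {ediam (E w) | w. w \<in> words_of_length I (Suc n) \<and> butlast w = trunc \<sigma> n}"

text \<open>
  Uniform convergence to \<open>1\<close>, spelled out because \<^typ>\<open>ereal\<close> is not a metric space. Since
  \<open>c / (-\<infinity>) = 0\<close>, it excludes construction sets of diameter \<open>0\<close> from some level on.
\<close>

definition M5 ::
    "(nat \<Rightarrow> 'i set) \<Rightarrow> ('i list \<Rightarrow> 'a::metric_space set) \<Rightarrow> bool" where
  "M5 I E \<longleftrightarrow>
     (\<forall>\<epsilon>::real. \<epsilon> > 0 \<longrightarrow>
        (\<forall>\<^sub>F n in sequentially. \<forall>\<sigma>\<in>seqs I.
           \<bar>elog (ediam (E (trunc \<sigma> n))) / elog (min_child_diam I E \<sigma> n) - 1\<bar> < ereal \<epsilon>))"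


section \<open>Measures and local dimensions\<close>

text \<open>
  Borel sets are measurable, and every measurable set lies in a Borel set of the same measure.
  The \<open>\<sigma>\<close>-algebra may be larger than the Borel one, so this covers both Borel measures in the
  strict sense and Borel regular outer measures restricted to their measurable sets.
\<close>

definition borel_regular :: "'b topology \<Rightarrow> 'b measure \<Rightarrow> bool" where
  "borel_regular T M \<longleftrightarrow>
     space M = topspace T \<and>
     sigma_sets (topspace T) {U. openin T U} \<subseteq> sets M \<and>
     (\<forall>A\<in>sets M. \<exists>B\<in>sigma_sets (topspace T) {U. openin T U}.
        A \<subseteq> B \<and> emeasure M B = emeasure M A)"

definition lower_local_dim :: "'a::metric_space measure \<Rightarrow> 'a \<Rightarrow> ereal" where
  "lower_local_dim \<nu> x =
     Liminf (at_right 0) (\<lambda>r. elog (emeasure \<nu> (cball x r)) / elog (ennreal r))"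

definition upper_local_dim :: "'a::metric_space measure \<Rightarrow> 'a \<Rightarrow> ereal" where
  "upper_local_dim \<nu> x =
     Limsup (at_right 0) (\<lambda>r. elog (emeasure \<nu> (cball x r)) / elog (ennreal r))"

end

theory Submission
  imports Defs
begin

text \<open>
  Let \<open>\<nu> = \<pi>\<mu>\<close>. A ball of radius \<open>diam E\<^bsub>\<sigma>|n\<^esub>\<close> around \<open>\<pi>(\<sigma>)\<close> contains the image of the cylinder
  \<open>[\<sigma>|n]\<close>, which bounds the local dimensions from above. For the lower bounds one needs, for
  almost every \<open>\<sigma>\<close> and every \<open>\<epsilon> > 0\<close>, that \<open>\<nu>(B(\<pi>(\<sigma>), r/e)) \<le> r\<^sup>-\<^sup>\<epsilon> \<mu>[v]\<close> for all small
  \<open>r = exp (-k)\<close>, where \<open>v\<close> is the first prefix of \<open>\<sigma>\<close> with \<open>diam E\<^sub>v \<le> r\<close>. Choose a point \<open>x\<^sub>v\<close> in each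
  \<open>E\<^sub>v\<close> for which this fails. The total \<open>\<mu>\<close>-mass of these \<open>[v]\<close> is at most
  \<open>r\<^sup>\<epsilon> \<Sum>\<^sub>v \<nu>(B(x\<^sub>v, r/e)) = r\<^sup>\<epsilon> \<integral> #{v. x\<^sub>v \<in> B(y, r/e)} d\<nu>(y)\<close>, finite clustering bounds the integrand,
  and Borel--Cantelli applies along \<open>k\<close>.
\<close>

section \<open>Comparing growth rates\<close>

text \<open>For negative \<open>u\<close>, the product \<open>u * g\<close> eventually drops below
  \<open>- \<bar>c\<bar>\<close> and hence below \<open>f\<close>. Numerators \<open>- ln m\<close>
  can be negative when the total mass exceeds 1, so nonnegativity is only asserted in the
  limit.\<close>

lemma Liminf_quotient_nonneg:
  fixes f :: "'b \<Rightarrow> real" and g :: "'b \<Rightarrow> real"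
  assumes g: "filterlim g at_top F" and f: "\<And>x. - c \<le> f x"
  shows "0 \<le> Liminf F (\<lambda>x. ereal (f x / g x))"
  unfolding le_Liminf_iff
proof (intro allI impI)
  fix y :: ereal assume "y < 0"
  then obtain u where u: "y < ereal u" "u < 0"
    using ereal_dense2[of y 0] by (auto simp: zero_ereal_def)
  have "\<forall>\<^sub>F x in F. \<bar>c\<bar> / - u < g x" "\<forall>\<^sub>F x in F. 0 < g x"
    using g by (auto simp: filterlim_at_top_dense)
  then show "\<forall>\<^sub>F x in F. y < ereal (f x / g x)"
  proof eventually_elim
    case (elim x)
    then have "u * g x < f x"
      using u f[of x] by (simp add: field_simps)
    then have "u < f x / g x" using elim by (simp add: field_simps)
    then show ?case using u by (meson less_ereal.simps(1) less_trans)
  qed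
qed

text \<open>
  The intended reading is \<open>l n = - ln (diam E\<^bsub>\<sigma>|n+1\<^esub>)\<close>, \<open>h n = - ln (\<mu>[\<sigma>|n+1])\<close> and
  \<open>G t = - ln (\<nu>(B(\<pi>(\<sigma>), exp (- t))))\<close>.
\<close>

locale growth_profile =
  fixes l h :: "nat \<Rightarrow> real" and G :: "real \<Rightarrow> real" and c :: real
  assumes l_mono: "mono l" and l_top: "filterlim l at_top sequentially"
    and h_mono: "mono h" and G_mono: "mono G" and G_bound: "- c \<le> G t"
    and G_le: "t \<le> l n \<Longrightarrow> G t \<le> h n"
    and G_ge: "\<epsilon> > 0 \<Longrightarrow> \<forall>\<^sub>F k in sequentially. \<forall>n. l n < real k \<and> real k \<le> l (Suc n) \<longrightarrow>
       h (Suc n) - \<epsilon> * real k \<le> G (real k + 1)"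
begin

text \<open>\<open>Suc n\<close> is the first index at which \<open>l\<close> reaches
  \<open>t\<close>; in the intended reading it marks the prefix of the code whose diameter first
  drops to \<open>exp (- t)\<close>.\<close>

lemma crossing:
  assumes "l N < t"
  obtains n where "n \<ge> N" "l n < t" "t \<le> l (Suc n)"
proof -
  obtain m where m: "t \<le> l m"
    using l_top by (auto simp: filterlim_at_top eventually_sequentially)
  define p where "p = (LEAST m. t \<le> l m)"
  have p: "t \<le> l p" using m unfolding p_def by (rule LeastI)
  have less: "l q < t" if "q < p" for q
    using not_less_Least[of q "\<lambda>m. t \<le> l m"] that unfolding p_def by auto
  have "N < p"
    using p assms monoD[OF l_mono, of p N] by (meson leD le_less_trans not_le)
  then obtain n where "p = Suc n" by (cases p) auto
  with p less[of n] \<open>N < p\<close> show ?thesis by (intro that[of n]) auto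
qed

lemma h_bound: "- c \<le> h n"
  using G_bound[of "l n"] G_le[of "l n" n] by linarith

lemma liminf_nonneg: "0 \<le> liminf (\<lambda>n. ereal (h n / l n))"
  by (rule Liminf_quotient_nonneg[OF l_top h_bound])

lemma Liminf_G_nonneg: "0 \<le> Liminf at_top (\<lambda>t. ereal (G t / t))"
  by (rule Liminf_quotient_nonneg[OF filterlim_ident G_bound])

text \<open>Sampling \<open>G\<close> at \<open>t = l n\<close> can only raise the lower limit, and
  there \<open>G (l n) \<le> h n\<close>.\<close>

lemma Liminf_G_le: "Liminf at_top (\<lambda>t. ereal (G t / t)) \<le> liminf (\<lambda>n. ereal (h n / l n))"
  unfolding le_Liminf_iff
proof (intro allI impI)
  fix y assume "y < Liminf at_top (\<lambda>t. ereal (G t / t))"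
  then have "\<forall>\<^sub>F t in at_top. y < ereal (G t / t)" by (rule less_LiminfD)
  then have "\<forall>\<^sub>F n in sequentially. y < ereal (G (l n) / l n)"
    using l_top by (rule eventually_compose_filterlim)
  moreover have "\<forall>\<^sub>F n in sequentially. 0 < l n"
    using l_top by (auto simp: filterlim_at_top_dense)
  ultimately show "\<forall>\<^sub>F n in sequentially. y < ereal (h n / l n)"
  proof eventually_elim
    case (elim n)
    have "G (l n) / l n \<le> h n / l n"
      using G_le[of "l n" n] elim by (simp add: divide_right_mono)
    then show ?case using elim by (meson ereal_less_eq(3) less_le_trans)
  qed
qed

text \<open>For an integer \<open>k\<close> just below \<open>t\<close> and the index with
  \<open>l n < k \<le> l (Suc n)\<close>, the chain \<open>G t \<ge> G (k + 1) \<ge> h (Suc n) -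
  \<epsilon> * k \<ge> (s - \<epsilon>) * k\<close> transfers a growth rate \<open>s\<close> of
  \<open>h\<close> to \<open>G\<close>, up to \<open>\<epsilon>\<close> and a bounded shift of
  \<open>t\<close>.\<close>

lemma liminf_le_Liminf_G: "liminf (\<lambda>n. ereal (h n / l n)) \<le> Liminf at_top (\<lambda>t. ereal (G t / t))"
proof (rule dense_le)
  fix y assume y: "y < liminf (\<lambda>n. ereal (h n / l n))"
  show "y \<le> Liminf at_top (\<lambda>t. ereal (G t / t))"
  proof (cases "y \<le> 0")
    case True
    then show ?thesis using Liminf_G_nonneg by (rule order_trans)
  next
    case False
    with y obtain u where u: "y = ereal u" "0 < u" by (cases y) auto
    obtain s where s: "u < s" "ereal s < liminf (\<lambda>n. ereal (h n / l n))"
      using ereal_dense2[OF y] u by auto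
    \<comment> \<open>Half of the gap pays for the loss in \<open>G_ge\<close>, the other half for
      replacing \<open>t\<close> by \<open>k\<close>.\<close>
    define \<epsilon> where "\<epsilon> = (s - u) / 2"
    have \<epsilon>: "\<epsilon> > 0" "s - \<epsilon> - u = \<epsilon>" "0 < s - \<epsilon>" using s u by (auto simp: \<epsilon>_def field_simps)
    have "\<forall>\<^sub>F n in sequentially. s < h n / l n"
      using less_LiminfD[OF s(2)] by simp
    moreover have "\<forall>\<^sub>F n in sequentially. 0 < l n"
      using l_top by (auto simp: filterlim_at_top_dense)
    ultimately have "\<forall>\<^sub>F n in sequentially. s * l n < h n"
      by eventually_elim (simp add: field_simps)
    then obtain N where N: "\<And>n. n \<ge> N \<Longrightarrow> s * l n < h n"
      by (auto simp: eventually_sequentially)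
    obtain K where K: "\<And>k n. k \<ge> K \<Longrightarrow> l n < real k \<Longrightarrow> real k \<le> l (Suc n) \<Longrightarrow>
        h (Suc n) - \<epsilon> * real k \<le> G (real k + 1)"
      using G_ge[OF \<epsilon>(1)] by (auto simp: eventually_sequentially)
    \<comment> \<open>The first three summands push \<open>k\<close>, which exceeds
      \<open>t - 2\<close>, beyond \<open>K\<close> and \<open>l N\<close>; the last one yields
      \<open>u * t \<le> (s - \<epsilon>) * (t - 2)\<close>.\<close>
    have "\<forall>\<^sub>F t in at_top. t > real K + \<bar>l N\<bar> + 2 + 2 * (s - \<epsilon>) / \<epsilon>"
      by (rule eventually_gt_at_top)
    then have "\<forall>\<^sub>F t in at_top. y \<le> ereal (G t / t)"
    proof eventually_elim
      case (elim t)
      have pos: "2 * (s - \<epsilon>) / \<epsilon> > 0" using \<epsilon> by simp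
      \<comment> \<open>\<open>k + 1\<close> is the integer part of \<open>t\<close>, because
        \<open>G_ge\<close> controls \<open>G\<close> at \<open>k + 1\<close>.\<close>
      define k where "k = nat \<lfloor>t\<rfloor> - 1"
      have t2: "t > 2" using elim pos by linarith
      have k: "real k + 1 \<le> t" "t < real k + 2"
        using t2 unfolding k_def by linarith+
      have "real K < real k" "l N < real k" using elim pos k by linarith+
      then obtain n where n: "n \<ge> N" "l n < real k" "real k \<le> l (Suc n)"
        using crossing by blast
      have "(s - \<epsilon>) * (t - 2) \<le> (s - \<epsilon>) * real k"
        using \<epsilon> k by (intro mult_left_mono) auto
      also have "\<dots> \<le> s * l (Suc n) - \<epsilon> * real k"
        using n s u mult_left_mono[of "real k" "l (Suc n)" s] by (simp add: algebra_simps)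
      also have "\<dots> \<le> h (Suc n) - \<epsilon> * real k"
        using N[of "Suc n"] n by simp
      also have "\<dots> \<le> G (real k + 1)"
        using K[OF _ n(2,3)] \<open>real K < real k\<close> by simp
      also have "\<dots> \<le> G t" using k by (intro monoD[OF G_mono])
      finally have 1: "(s - \<epsilon>) * (t - 2) \<le> G t" .
      have "2 * (s - \<epsilon>) / \<epsilon> < t" using elim by linarith
      then have "2 * (s - \<epsilon>) < \<epsilon> * t" using \<epsilon>(1) by (simp add: field_simps)
      also have "\<dots> = (s - \<epsilon> - u) * t" using \<epsilon>(2) by simp
      finally have "u * t \<le> (s - \<epsilon>) * (t - 2)" by (simp add: algebra_simps)
      with 1 have "u * t \<le> G t" by linarith
      then show ?case using t2 u by (simp add: field_simps)
    qed
    then show ?thesis by (rule Liminf_bounded)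
  qed
qed

text \<open>If \<open>h n > s * l n\<close> and \<open>k\<close> is the integer just above
  \<open>l n\<close>, the index \<open>m\<close> at which \<open>l\<close> crosses \<open>k\<close>
  may be far beyond \<open>n\<close>, but monotonicity keeps \<open>h (Suc m) \<ge> h n\<close>.
  Then \<open>G (k + 1)\<close> is at least about \<open>(s - \<epsilon>) * k\<close>, against
  \<open>G (k + 1) < u * (k + 1)\<close> for large \<open>k\<close>.\<close>

lemma limsup_le_Limsup_G: "limsup (\<lambda>n. ereal (h n / l n)) \<le> Limsup at_top (\<lambda>t. ereal (G t / t))"
proof (rule ccontr)
  assume "\<not> ?thesis"
  then have less: "Limsup at_top (\<lambda>t. ereal (G t / t)) < limsup (\<lambda>n. ereal (h n / l n))"
    by simp
  have nonneg: "0 \<le> Limsup at_top (\<lambda>t. ereal (G t / t))"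
    using Liminf_G_nonneg Liminf_le_Limsup[of at_top "\<lambda>t. ereal (G t / t)"]
    by (meson order_trans trivial_limit_at_top_linorder)
  obtain u where u: "Limsup at_top (\<lambda>t. ereal (G t / t)) < ereal u"
    "ereal u < limsup (\<lambda>n. ereal (h n / l n))"
    using ereal_dense2[OF less] by auto
  obtain s where s: "u < s" "ereal s < limsup (\<lambda>n. ereal (h n / l n))"
    using ereal_dense2[OF u(2)] by auto
  have u0: "0 < u" using nonneg u(1) by (metis le_less_trans ereal_less(2))
  define \<epsilon> where "\<epsilon> = (s - u) / 2"
  have \<epsilon>: "\<epsilon> > 0" "s - \<epsilon> - u = \<epsilon>" using s u by (auto simp: \<epsilon>_def field_simps)
  obtain T where T: "\<And>t. t \<ge> T \<Longrightarrow> G t / t < u"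
    using Limsup_lessD[OF u(1)] by (auto simp: eventually_at_top_linorder)
  obtain K where K: "\<And>k n. k \<ge> K \<Longrightarrow> l n < real k \<Longrightarrow> real k \<le> l (Suc n) \<Longrightarrow>
      h (Suc n) - \<epsilon> * real k \<le> G (real k + 1)"
    using G_ge[OF \<epsilon>(1)] by (auto simp: eventually_sequentially)
  have "\<forall>\<^sub>F n in sequentially. h n / l n \<le> s"
  proof -
    \<comment> \<open>\<open>(s + u) / \<epsilon>\<close> is the upper bound on \<open>k\<close>
      that the chain of inequalities below produces.\<close>
    have "\<forall>\<^sub>F n in sequentially. l n > real K + \<bar>T\<bar> + (s + u) / \<epsilon>"
      using l_top by (auto simp: filterlim_at_top_dense)
    then show ?thesis
    proof eventually_elim
      case (elim n)
      show ?case
      proof (rule ccontr)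
        assume "\<not> ?thesis"
        moreover have pos: "(s + u) / \<epsilon> > 0" using \<epsilon> u0 s by simp
        moreover have ln: "0 < l n" using elim pos by linarith
        ultimately have sn: "s * l n \<le> h n" by (simp add: field_simps)
        \<comment> \<open>Adding one makes \<open>k\<close> strictly larger than \<open>l n\<close>,
          as \<open>crossing\<close> demands, and still within distance 1 of it.\<close>
        define k where "k = Suc (nat \<lfloor>l n\<rfloor>)"
        have k: "l n < real k" "real k \<le> l n + 1"
          unfolding k_def using ln by linarith+
        obtain m where m: "m \<ge> n" "l m < real k" "real k \<le> l (Suc m)"
          using crossing[OF k(1)] by blast
        have "s * (real k - 1) - \<epsilon> * real k \<le> s * l n - \<epsilon> * real k"
          using k s u0 by (simp add: mult_left_mono)
        also have "\<dots> \<le> h (Suc m) - \<epsilon> * real k"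
          using sn monoD[OF h_mono, of n "Suc m"] m by simp
        also have "\<dots> \<le> G (real k + 1)"
          using K[OF _ m(2,3)] elim pos k by linarith
        also have "\<dots> < u * (real k + 1)"
          using T[of "real k + 1"] elim pos k by (simp add: field_simps)
        finally have "(s - \<epsilon> - u) * real k < s + u" by (simp add: algebra_simps)
        then have "real k < (s + u) / \<epsilon>" using \<epsilon> by (simp add: field_simps)
        then show False using elim k by linarith
      qed
    qed
  qed
  then have "limsup (\<lambda>n. ereal (h n / l n)) \<le> ereal s"
    by (intro Limsup_bounded) simp
  with s show False by simp
qed

text \<open>For \<open>l n < t \<le> l (Suc n)\<close> the bound \<open>G t \<le> h (Suc n)\<close>
  belongs to the scale \<open>l (Suc n)\<close>; by \<open>regular\<close> this scale exceeds
  \<open>t\<close> at most by a factor close to 1.\<close>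

lemma Limsup_G_le:
  assumes regular: "\<And>\<epsilon>. 0 < \<epsilon> \<Longrightarrow> \<epsilon> < 1 \<Longrightarrow> \<forall>\<^sub>F n in sequentially. (1 - \<epsilon>) * l (Suc n) \<le> l n"
  shows "Limsup at_top (\<lambda>t. ereal (G t / t)) \<le> limsup (\<lambda>n. ereal (h n / l n))"
proof (rule dense_ge)
  fix y assume y: "limsup (\<lambda>n. ereal (h n / l n)) < y"
  have nonneg: "0 \<le> limsup (\<lambda>n. ereal (h n / l n))"
    using liminf_nonneg Liminf_le_Limsup[of sequentially] by (meson order_trans trivial_limit_sequentially)
  show "Limsup at_top (\<lambda>t. ereal (G t / t)) \<le> y"
  proof (cases y)
    case (real u)
    obtain s where s: "limsup (\<lambda>n. ereal (h n / l n)) < ereal s" "s < u"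
      using ereal_dense2[OF y] real by auto
    have s0: "0 < s" using nonneg s(1) by (metis le_less_trans ereal_less(2))
    \<comment> \<open>With this choice \<open>1 - \<epsilon> = s / u\<close>, so the loss from
      \<open>regular\<close> turns \<open>s\<close> exactly into \<open>u\<close>.\<close>
    define \<epsilon> where "\<epsilon> = 1 - s / u"
    have \<epsilon>: "0 < \<epsilon>" "\<epsilon> < 1" using s s0 by (auto simp: \<epsilon>_def field_simps)
    have "\<forall>\<^sub>F n in sequentially. h n / l n < s"
      using Limsup_lessD[OF s(1)] by simp
    moreover have "\<forall>\<^sub>F n in sequentially. 0 < l n"
      using l_top by (auto simp: filterlim_at_top_dense)
    ultimately have "\<forall>\<^sub>F n in sequentially. h n < s * l n \<and> (1 - \<epsilon>) * l (Suc n) \<le> l n"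
      using regular[OF \<epsilon>] by eventually_elim (simp add: field_simps)
    then obtain N where N: "\<And>n. n \<ge> N \<Longrightarrow> h n < s * l n \<and> (1 - \<epsilon>) * l (Suc n) \<le> l n"
      by (auto simp: eventually_sequentially)
    have "\<forall>\<^sub>F t in at_top. t > \<bar>l N\<bar>" by (rule eventually_gt_at_top)
    then have "\<forall>\<^sub>F t in at_top. ereal (G t / t) \<le> y"
    proof eventually_elim
      case (elim t)
      then have t: "0 < t" "l N < t" by linarith+
      obtain n where n: "n \<ge> N" "l n < t" "t \<le> l (Suc n)" using crossing[OF t(2)] by blast
      have "s / u * l (Suc n) \<le> t" using N[of n] n by (simp add: \<epsilon>_def)
      then have "s * l (Suc n) \<le> u * t" using s s0 by (simp add: field_simps)
      moreover have "G t \<le> h (Suc n)" by (rule G_le[OF n(3)])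
      ultimately have "G t \<le> u * t" using N[of "Suc n"] n(1) by auto
      then show ?case using t real by (simp add: field_simps)
    qed
    then show ?thesis by (rule Limsup_bounded)
  qed (use y nonneg in auto)
qed

end

section \<open>Coding of the limit set\<close>

lemma ediam_mono:
  assumes "S \<subseteq> T"
  shows "ediam S \<le> ediam T"
  using assms bounded_subset[of T S] diameter_subset[of S T]
  by (auto simp: ediam_def intro: ennreal_leI)

section \<open>Prefixes, words and cylinders\<close>

lemma length_trunc [simp]: "length (trunc \<sigma> n) = n"
  by (simp add: trunc_def)

lemma butlast_trunc [simp]: "butlast (trunc \<sigma> (Suc n)) = trunc \<sigma> n"
  by (simp add: trunc_def)

lemma trunc_eq_iff: "trunc \<omega> n = trunc \<tau> n \<longleftrightarrow> (\<forall>j<n. \<omega> j = \<tau> j)"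
  by (auto simp: trunc_def)

lemma mem_cylinder: "\<omega> \<in> cylinder I w \<longleftrightarrow> \<omega> \<in> seqs I \<and> trunc \<omega> (length w) = w"
  by (simp add: cylinder_def)

lemma trunc_in_words: "\<sigma> \<in> seqs I \<Longrightarrow> trunc \<sigma> (Suc n) \<in> words I"
  by (auto simp: words_def words_of_length_def intro!: bexI[of _ "Suc n"])

lemma wordsE:
  assumes "w \<in> words I"
  obtains \<sigma> n where "\<sigma> \<in> seqs I" "w = trunc \<sigma> (Suc n)"
proof -
  from assms obtain \<sigma> k where "\<sigma> \<in> seqs I" "w = trunc \<sigma> k" "k \<ge> 1"
    by (auto simp: words_def words_of_length_def)
  then show thesis by (cases k) (auto intro: that)
qed

text \<open>A nonempty cylinder is the box pinning the first \<open>length w\<close> coordinates to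
  those of a member \<open>\<tau>\<close>; only finitely many factors differ from the full
  alphabet.\<close>

lemma openin_cylinder: "openin (seqs_topology I) (cylinder I w)"
proof (cases "cylinder I w = {}")
  case False
  then obtain \<tau> where \<tau>: "\<tau> \<in> seqs I" "trunc \<tau> (length w) = w"
    by (auto simp: mem_cylinder)
  have "cylinder I w = {\<omega> \<in> seqs I. \<forall>j<length w. \<omega> j = \<tau> j}"
    using \<tau>(2) trunc_eq_iff[of _ "length w" \<tau>] by (auto simp: cylinder_def)
  also have "\<dots> = (\<Pi>\<^sub>E j\<in>UNIV. if j < length w then {\<tau> j} else I j)"
  proof (intro set_eqI iffI)
    fix \<omega> assume *: "\<omega> \<in> (\<Pi>\<^sub>E j\<in>UNIV. if j < length w then {\<tau> j} else I j)"
    have "\<omega> j \<in> I j \<and> (j < length w \<longrightarrow> \<omega> j = \<tau> j)" for j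
      using PiE_mem[OF *, of j] \<tau>(1) by (auto simp: seqs_def split: if_splits)
    then show "\<omega> \<in> {\<omega> \<in> seqs I. \<forall>j<length w. \<omega> j = \<tau> j}" by (auto simp: seqs_def)
  qed (auto simp: seqs_def PiE_iff)
  finally have "cylinder I w = (\<Pi>\<^sub>E j\<in>UNIV. if j < length w then {\<tau> j} else I j)" .
  moreover have "openin (seqs_topology I) \<dots>"
    unfolding seqs_topology_def
  proof (subst openin_PiE_gen, intro disjI2 conjI ballI)
    show "finite {j \<in> UNIV. (if j < length w then {\<tau> j} else I j) \<noteq> topspace (discrete_topology (I j))}"
      by (rule finite_subset[of _ "{..<length w}"]) auto
    show "openin (discrete_topology (I j)) (if j < length w then {\<tau> j} else I j)" for j
      using \<tau>(1) by (auto simp: seqs_def PiE_iff)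
  qed
  ultimately show ?thesis by simp
qed simp

section \<open>Construction sets along a code, and measurability of the coding map\<close>

locale moran_coding = finite_measure \<mu> for \<mu> :: "(nat \<Rightarrow> 'i) measure" +
  fixes I :: "nat \<Rightarrow> 'i set" and E :: "'i list \<Rightarrow> 'a::polish_space set"
  assumes moran: "moran_construction I E"
    and clustering: "finite_clustering I E"
    and regular: "borel_regular (seqs_topology I) \<mu>"
begin

abbreviation "\<pi> \<equiv> code_map E"
abbreviation "\<nu> \<equiv> distr \<mu> borel \<pi>"
abbreviation "cyl \<sigma> n \<equiv> cylinder I (trunc \<sigma> n)"
abbreviation "diam \<sigma> n \<equiv> diameter (E (trunc \<sigma> (Suc n)))"

lemma space_\<mu> [simp]: "space \<mu> = seqs I"
  using regular by (simp add: borel_regular_def seqs_topology_def seqs_def)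

lemma cylinder_sets [measurable]: "cylinder I w \<in> sets \<mu>"
  using regular openin_cylinder[of I w] by (auto simp: borel_regular_def)

lemma countable_words: "countable (words I)"
proof (rule countable_subset)
  have "countable (\<Union>j. I j)"
    using moran by (intro countable_UN) (auto simp: moran_construction_def intro: countable_finite)
  then show "countable (lists (\<Union>j. I j))" by simp
  show "words I \<subseteq> lists (\<Union>j. I j)"
    by (fastforce simp: words_def words_of_length_def seqs_def trunc_def PiE_iff)
qed

lemma word_compact: "w \<in> words I \<Longrightarrow> compact (E w)"
  and word_nonempty: "w \<in> words I \<Longrightarrow> E w \<noteq> {}"
  and word_butlast: "w \<in> words I \<Longrightarrow> E w \<subseteq> E (butlast w)"
  using moran by (auto simp: moran_construction_def)

lemma E_antimono:
  assumes "\<sigma> \<in> seqs I" "m \<le> n"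
  shows "E (trunc \<sigma> n) \<subseteq> E (trunc \<sigma> m)"
  using assms(2)
proof (induction rule: dec_induct)
  case (step n)
  then show ?case using word_butlast[OF trunc_in_words[OF assms(1), of n]] by simp
qed simp

lemma ediam_Suc: "\<sigma> \<in> seqs I \<Longrightarrow> ediam (E (trunc \<sigma> (Suc n))) = ennreal (diam \<sigma> n)"
  using word_compact[OF trunc_in_words] by (simp add: ediam_def compact_imp_bounded)

lemma diam_nonneg: "\<sigma> \<in> seqs I \<Longrightarrow> 0 \<le> diam \<sigma> n"
  using word_compact[OF trunc_in_words] by (simp add: diameter_ge_0 compact_imp_bounded)

lemma diam_antimono: "\<sigma> \<in> seqs I \<Longrightarrow> m \<le> n \<Longrightarrow> diam \<sigma> n \<le> diam \<sigma> m"
  using word_compact[OF trunc_in_words]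
  by (intro diameter_subset E_antimono) (auto simp: compact_imp_bounded)

lemma diam_tendsto: "\<sigma> \<in> seqs I \<Longrightarrow> diam \<sigma> \<longlonglongrightarrow> 0"
proof -
  assume \<sigma>: "\<sigma> \<in> seqs I"
  then have "(\<lambda>n. ediam (E (trunc \<sigma> n))) \<longlonglongrightarrow> 0"
    using moran by (auto simp: moran_construction_def)
  then have "(\<lambda>n. ennreal (diam \<sigma> n)) \<longlonglongrightarrow> ennreal 0"
    using LIMSEQ_Suc ediam_Suc[OF \<sigma>] by fastforce
  then show "diam \<sigma> \<longlonglongrightarrow> 0"
    using diam_nonneg[OF \<sigma>] by (subst (asm) tendsto_ennreal_iff) auto
qed

lemma dist_le_diam:
  "\<sigma> \<in> seqs I \<Longrightarrow> x \<in> E (trunc \<sigma> (Suc n)) \<Longrightarrow> y \<in> E (trunc \<sigma> (Suc n)) \<Longrightarrow> dist x y \<le> diam \<sigma> n"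
  using word_compact[OF trunc_in_words] by (simp add: diameter_bounded_bound compact_imp_bounded)

text \<open>By completeness, Cantor's intersection theorem gives the nested sets exactly one common
  point, so the definite description in \<open>code_map\<close> is meaningful. Indices start at
  \<open>Suc n\<close> because \<open>E []\<close> need not be closed.\<close>

lemma code_map_in:
  assumes \<sigma>: "\<sigma> \<in> seqs I"
  shows "\<pi> \<sigma> \<in> E (trunc \<sigma> (Suc n))"
proof -
  have "\<exists>a. \<Inter>(range (\<lambda>n. E (trunc \<sigma> (Suc n)))) = {a}"
  proof (rule decreasing_closed_nest_sing)
    show "closed (E (trunc \<sigma> (Suc n)))" for n
      using word_compact[OF trunc_in_words[OF \<sigma>]] by (rule compact_imp_closed)
    show "E (trunc \<sigma> (Suc n)) \<noteq> {}" for n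
      using word_nonempty[OF trunc_in_words[OF \<sigma>]] .
    show "E (trunc \<sigma> (Suc n)) \<subseteq> E (trunc \<sigma> (Suc m))" if "m \<le> n" for m n
      using E_antimono[OF \<sigma>] that by simp
    show "\<exists>n. \<forall>x\<in>E (trunc \<sigma> (Suc n)). \<forall>y\<in>E (trunc \<sigma> (Suc n)). dist x y < \<epsilon>" if \<epsilon>: "\<epsilon> > 0" for \<epsilon>
    proof -
      obtain n where "diam \<sigma> n < \<epsilon>"
        using order_tendstoD(2)[OF diam_tendsto[OF \<sigma>] \<epsilon>] by (auto simp: eventually_sequentially)
      then show ?thesis using dist_le_diam[OF \<sigma>] by (meson le_less_trans)
    qed
  qed
  then obtain a where a: "(\<Inter>n. E (trunc \<sigma> (Suc n))) = {a}" by auto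
  have "{1..} = range Suc" by (auto simp: image_iff Suc_le_eq gr0_conv_Suc)
  then have "(\<Inter>n\<in>{1..}. E (trunc \<sigma> n)) = {a}" using a by (simp add: image_image)
  then have "\<pi> \<sigma> = a" unfolding code_map_def by simp
  with a show ?thesis by blast
qed

text \<open>Finite clustering speaks about points of \<open>limit_set I E\<close>; this makes it
  applicable at coded points.\<close>

lemma code_map_limit_set:
  assumes "\<sigma> \<in> seqs I"
  shows "\<pi> \<sigma> \<in> limit_set I E"
  unfolding limit_set_def
proof (rule INT_I)
  fix n :: nat assume "n \<in> {1..}"
  then obtain m where "n = Suc m" by (cases n) auto
  then show "\<pi> \<sigma> \<in> (\<Union>w\<in>words_of_length I n. E w)"
    using code_map_in[OF assms] assms by (auto simp: words_of_length_def)
qed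

text \<open>Since diameters shrink along every code, the preimage of an open \<open>U\<close> is the
  union of the cylinders of words with \<open>E w \<subseteq> U\<close>, and there are countably
  many words.\<close>

lemma code_map_measurable [measurable]: "\<pi> \<in> borel_measurable \<mu>"
proof (rule borel_measurableI)
  fix U :: "'a set" assume "open U"
  have "\<pi> -` U \<inter> space \<mu> = (\<Union>w\<in>{w \<in> words I. E w \<subseteq> U}. cylinder I w)" (is "_ = ?R")
  proof safe
    fix \<sigma> assume "\<sigma> \<in> space \<mu>" and U: "\<pi> \<sigma> \<in> U"
    then have \<sigma>: "\<sigma> \<in> seqs I" by simp
    obtain e where e: "e > 0" "ball (\<pi> \<sigma>) e \<subseteq> U"
      using \<open>open U\<close> U by (auto simp: open_contains_ball)
    obtain n where "diam \<sigma> n < e"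
      using order_tendstoD(2)[OF diam_tendsto[OF \<sigma>] e(1)] by (auto simp: eventually_sequentially)
    then have "E (trunc \<sigma> (Suc n)) \<subseteq> ball (\<pi> \<sigma>) e"
      using dist_le_diam[OF \<sigma> code_map_in[OF \<sigma>], of _ n] by (fastforce intro: le_less_trans)
    then show "\<sigma> \<in> ?R"
      using e \<sigma> trunc_in_words[OF \<sigma>] by (auto simp: mem_cylinder intro!: exI[of _ "trunc \<sigma> (Suc n)"])
  next
    fix \<sigma> w assume w: "w \<in> words I" "E w \<subseteq> U" "\<sigma> \<in> cylinder I w"
    obtain \<tau> n where "w = trunc \<tau> (Suc n)" using wordsE[OF w(1)] .
    then have "w = trunc \<sigma> (Suc n)" "\<sigma> \<in> seqs I" using w(3) by (auto simp: mem_cylinder)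
    then show "\<sigma> \<in> \<pi> -` U" "\<sigma> \<in> space \<mu>" using code_map_in[of \<sigma> n] w(2) by auto
  qed
  also have "\<dots> \<in> sets \<mu>"
    using countable_subset[OF _ countable_words] by (intro sets.countable_UN') auto
  finally show "\<pi> -` U \<inter> space \<mu> \<in> sets \<mu>" .
qed

section \<open>Comparing the masses of balls and cylinders\<close>

lemma finite_\<nu>: "finite_measure \<nu>"
  by (rule finite_measure_distr) simp

text \<open>All codes in the cylinder are mapped into one construction set, which contains
  \<open>\<pi> \<sigma>\<close> and has diameter at most \<open>r\<close>.\<close>

lemma measure_cylinder_le:
  assumes \<sigma>: "\<sigma> \<in> seqs I" and r: "diam \<sigma> n \<le> r"
  shows "measure \<mu> (cyl \<sigma> (Suc n)) \<le> measure \<nu> (cball (\<pi> \<sigma>) r)"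
proof -
  have "cyl \<sigma> (Suc n) \<subseteq> \<pi> -` cball (\<pi> \<sigma>) r \<inter> space \<mu>"
  proof
    fix \<tau> assume "\<tau> \<in> cyl \<sigma> (Suc n)"
    then have \<tau>: "\<tau> \<in> seqs I" "trunc \<tau> (Suc n) = trunc \<sigma> (Suc n)" by (auto simp: mem_cylinder)
    then show "\<tau> \<in> \<pi> -` cball (\<pi> \<sigma>) r \<inter> space \<mu>"
      using dist_le_diam[OF \<sigma> code_map_in[OF \<sigma>], of "\<pi> \<tau>" n] code_map_in[OF \<tau>(1), of n] r by auto
  qed
  then show ?thesis
    using measurable_sets[OF code_map_measurable, of "cball (\<pi> \<sigma>) r"]
    by (subst measure_distr) (auto intro!: finite_measure_mono)
qed

text \<open>Words with a common extension are prefixes of one another. If \<open>v\<close> were a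
  proper prefix of \<open>w\<close>, then \<open>E (butlast w) \<subseteq> E v\<close> would have
  diameter at most \<open>r\<close>, although \<open>w\<close> is cut where its parent still exceeds
  \<open>r\<close>.\<close>

lemma cylinders_disjoint:
  assumes "v \<in> words I" "w \<in> words I" "v \<noteq> w"
    and "ediam (E v) \<le> r" "r < ediam (E (butlast v))"
    and "ediam (E w) \<le> r" "r < ediam (E (butlast w))"
  shows "cylinder I v \<inter> cylinder I w = {}"
proof (rule ccontr)
  have no_prefix: False
    if "\<omega> \<in> seqs I" "a < b" "ediam (E (trunc \<omega> (Suc a))) \<le> r" "r < ediam (E (trunc \<omega> b))" for \<omega> a b
    using ediam_mono[OF E_antimono[OF that(1), of "Suc a" b]] that by auto
  assume "\<not> ?thesis"
  then obtain \<omega> where \<omega>: "\<omega> \<in> seqs I" "trunc \<omega> (length v) = v" "trunc \<omega> (length w) = w"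
    by (auto simp: mem_cylinder)
  moreover obtain a b where ab: "length v = Suc a" "length w = Suc b"
    using wordsE[OF assms(1)] wordsE[OF assms(2)] by (metis length_trunc)
  ultimately have vw: "v = trunc \<omega> (Suc a)" "w = trunc \<omega> (Suc b)" by auto
  with assms(3) consider "a < b" | "b < a" by (metis linorder_less_linear)
  then show False
    using no_prefix[OF \<omega>(1), of a b] no_prefix[OF \<omega>(1), of b a] assms vw by cases auto
qed

text \<open>
  By Tonelli the sum of the ball masses \<open>\<nu> (cball (x v) s)\<close> is the \<open>\<nu>\<close>-integral of
  the number of \<open>v\<close> with \<open>x v\<close> close to \<open>y\<close>. All these points lie within \<open>2 * s \<le> r\<close> of any one of
  them, so finite clustering is only needed at the points \<open>x v\<close> and not at \<open>y\<close>.
\<close>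

lemma emeasure_cylinders_le:
  assumes B: "B \<subseteq> words I"
    and level: "\<And>v. v \<in> B \<Longrightarrow> ediam (E v) \<le> ennreal r \<and> ennreal r < ediam (E (butlast v))"
    and x: "\<And>v. v \<in> B \<Longrightarrow> x v \<in> E v"
    and C: "\<And>v. v \<in> B \<Longrightarrow> emeasure (count_space UNIV) (cluster I E (x v) r) \<le> C"
    and s: "2 * s \<le> r"
    and bad: "\<And>v. v \<in> B \<Longrightarrow> a * emeasure \<mu> (cylinder I v) \<le> emeasure \<nu> (cball (x v) s)"
  shows "a * emeasure \<mu> (\<Union>v\<in>B. cylinder I v) \<le> C * emeasure \<mu> (space \<mu>)"
proof -
  have countable: "countable B" using B countable_words by (rule countable_subset)
  have disj: "disjoint_family_on (cylinder I) B"
    using cylinders_disjoint B level unfolding disjoint_family_on_def by (metis subsetD)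
  have count: "(\<integral>\<^sup>+v. indicator (cball (x v) s) y \<partial>count_space B) \<le> C" for y
  proof -
    let ?V = "{v \<in> B. y \<in> cball (x v) s}"
    have "(\<integral>\<^sup>+v. indicator (cball (x v) s) y \<partial>count_space B)
        = (\<integral>\<^sup>+v. indicator ?V v \<partial>count_space B)"
      by (intro nn_integral_cong) (auto simp: indicator_def)
    also have "\<dots> = emeasure (count_space B) ?V" by simp
    also have "\<dots> = emeasure (count_space UNIV) ?V" by (simp add: emeasure_count_space)
    also have "\<dots> \<le> C"
    proof (cases "?V = {}")
      case True
      show ?thesis unfolding True by simp
    next
      case False
      then obtain w where w: "w \<in> B" "dist (x w) y \<le> s" by auto
      have "?V \<subseteq> cluster I E (x w) r"
      proof
        fix v assume v: "v \<in> ?V"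
        then have "dist (x w) (x v) \<le> r"
          using w s dist_triangle[of "x w" "x v" y] by (simp add: dist_commute)
        then have "x v \<in> E v \<inter> cball (x w) r" using v x by auto
        then show "v \<in> cluster I E (x w) r"
          using v B level unfolding cluster_def by blast
      qed
      then have "emeasure (count_space UNIV) ?V \<le> emeasure (count_space UNIV) (cluster I E (x w) r)"
        by (intro emeasure_mono) auto
      then show ?thesis using C[OF w(1)] by (rule order_trans)
    qed
    finally show ?thesis .
  qed
  \<comment> \<open>Disjointness turns the mass of the union into a sum, written as an integral over
    \<open>count_space B\<close> so that Tonelli applies.\<close>
  have "a * emeasure \<mu> (\<Union>v\<in>B. cylinder I v) = (\<integral>\<^sup>+v. a * emeasure \<mu> (cylinder I v) \<partial>count_space B)"
    using countable disj by (subst emeasure_UN_countable) (auto simp: nn_integral_cmult)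
  also have "\<dots> \<le> (\<integral>\<^sup>+v. emeasure \<nu> (cball (x v) s) \<partial>count_space B)"
    using bad by (intro nn_integral_mono) auto
  also have "\<dots> = (\<integral>\<^sup>+v. \<integral>\<^sup>+y. indicator (cball (x v) s) y \<partial>\<nu> \<partial>count_space B)"
    by (intro nn_integral_cong) simp
  also have "\<dots> = (\<integral>\<^sup>+y. \<integral>\<^sup>+v. indicator (cball (x v) s) y \<partial>count_space B \<partial>\<nu>)"
    using countable
    by (intro nn_integral_count_space_nn_integral[symmetric] borel_measurable_indicator) auto
  also have "\<dots> \<le> (\<integral>\<^sup>+y. C \<partial>\<nu>)"
    using count by (intro nn_integral_mono)
  also have "\<dots> = C * emeasure \<mu> (space \<mu>)"
    by (simp add: emeasure_distr)
  finally show ?thesis .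
qed

text \<open>Finite clustering bounds the counts only below a radius depending on the point; on
  \<open>Y\<close> both radius and bound are uniform. The exceptional set at scale
  \<open>exp (- k)\<close> then has mass at most a constant times
  \<open>exp (- \<epsilon>) ^ k\<close>, which is summable.\<close>

lemma ball_bound_AE_on:
  fixes C \<rho> \<epsilon> :: real
  assumes "\<rho> > 0" "\<epsilon> > 0"
    and C: "\<And>y r. y \<in> Y \<Longrightarrow> 0 < r \<Longrightarrow> r < \<rho> \<Longrightarrow>
      emeasure (count_space UNIV) (cluster I E y r) \<le> ennreal C"
  shows "AE \<sigma> in \<mu>. \<pi> \<sigma> \<in> Y \<longrightarrow> (\<forall>\<^sub>F k in sequentially. \<forall>n.
           ediam (E (trunc \<sigma> (Suc n))) \<le> ennreal (exp (- real k)) \<and>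
           ennreal (exp (- real k)) < ediam (E (trunc \<sigma> n)) \<longrightarrow>
           measure \<nu> (cball (\<pi> \<sigma>) (exp (- (real k + 1))))
             \<le> exp (\<epsilon> * real k) * measure \<mu> (cyl \<sigma> (Suc n)))"
proof -
  let ?level = "\<lambda>k v. ediam (E v) \<le> ennreal (exp (- real k)) \<and> ennreal (exp (- real k)) < ediam (E (butlast v))"
  let ?bad = "\<lambda>k v \<tau>. \<tau> \<in> cylinder I v \<and> \<pi> \<tau> \<in> Y \<and>
    exp (\<epsilon> * real k) * measure \<mu> (cylinder I v) < measure \<nu> (cball (\<pi> \<tau>) (exp (- (real k + 1))))"
  \<comment> \<open>One bad code in \<open>Y\<close> condemns the whole cylinder of its prefix. Thus
    \<open>A k\<close> is a countable union of cylinders and measurable for an arbitrary set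
    \<open>Y\<close>.\<close>
  define B where "B k = {v \<in> words I. ?level k v \<and> (\<exists>\<tau>. ?bad k v \<tau>)}" for k
  define A where "A k = (\<Union>v\<in>B k. cylinder I v)" for k
  have A_sets: "A k \<in> sets \<mu>" for k
    unfolding A_def B_def using countable_subset[OF _ countable_words]
    by (intro sets.countable_UN') auto
  have A_le: "measure \<mu> (A k) \<le> C * measure \<mu> (space \<mu>) * exp (- \<epsilon>) ^ k"
    if k: "exp (- real k) < \<rho>" and C0: "0 \<le> C" for k
  proof -
    \<comment> \<open>One bad code per word; its image is the point chosen in
      \<open>E v\<close>.\<close>
    define \<tau> where "\<tau> v = (SOME \<tau>. ?bad k v \<tau>)" for v
    have \<tau>: "?bad k v (\<tau> v)" if "v \<in> B k" for v
      using that someI_ex[of "?bad k v"] unfolding \<tau>_def B_def by blast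
    have in_E: "\<pi> (\<tau> v) \<in> E v" if "v \<in> B k" for v
    proof -
      have "v \<in> words I" using that by (simp add: B_def)
      then obtain \<upsilon> n where "v = trunc \<upsilon> (Suc n)" using wordsE by blast
      then have "\<tau> v \<in> seqs I" "v = trunc (\<tau> v) (Suc n)" using \<tau>[OF that] by (auto simp: mem_cylinder)
      then show ?thesis using code_map_in by metis
    qed
    \<comment> \<open>This is why the balls have radius \<open>exp (- (k + 1))\<close>: it is at
      most half of the clustering scale \<open>exp (- k)\<close>.\<close>
    have "2 \<le> exp (1::real)" using exp_ge_add_one_self[of 1] by simp
    then have "2 * exp (- (real k + 1)) \<le> exp (- real k)"
      by (simp add: exp_diff exp_minus field_simps)
    then have "ennreal (exp (\<epsilon> * real k)) * emeasure \<mu> (A k) \<le> ennreal C * emeasure \<mu> (space \<mu>)"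
      unfolding A_def
      using \<tau> in_E C k
      by (intro emeasure_cylinders_le[where x = "\<lambda>v. \<pi> (\<tau> v)" and r = "exp (- real k)" and s = "exp (- (real k + 1))"])
        (auto simp: B_def emeasure_eq_measure finite_measure.emeasure_eq_measure[OF finite_\<nu>]
           ennreal_mult[symmetric] intro!: ennreal_leI less_imp_le)
    then have "exp (\<epsilon> * real k) * measure \<mu> (A k) \<le> C * measure \<mu> (space \<mu>)"
      using C0 by (simp add: emeasure_eq_measure ennreal_mult[symmetric] del: space_\<mu>)
    then show ?thesis
      by (simp add: exp_of_nat_mult[symmetric] exp_minus field_simps del: space_\<mu>)
  qed
  have "summable (\<lambda>k. measure \<mu> (A k))"
  proof (rule summable_comparison_test_ev)
    show "summable (\<lambda>k. \<bar>C\<bar> * measure \<mu> (space \<mu>) * exp (- \<epsilon>) ^ k)"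
      using \<open>\<epsilon> > 0\<close> by (intro summable_mult summable_geometric) simp
    have "((\<lambda>k. exp (- real k)) \<longlongrightarrow> 0) sequentially"
      by (intro filterlim_compose[OF exp_at_bot] filterlim_compose[OF filterlim_uminus_at_bot_at_top] filterlim_real_sequentially)
    then have "\<forall>\<^sub>F k in sequentially. exp (- real k) < \<rho>"
      using \<open>\<rho> > 0\<close> by (rule order_tendstoD)
    then show "\<forall>\<^sub>F k in sequentially. norm (measure \<mu> (A k)) \<le> \<bar>C\<bar> * measure \<mu> (space \<mu>) * exp (- \<epsilon>) ^ k"
    proof eventually_elim
      case (elim k)
      show ?case
      proof (cases "0 \<le> C")
        case True
        then show ?thesis using A_le[OF elim] by (simp del: space_\<mu>)
      next
        case False
        \<comment> \<open>A negative \<open>C\<close> becomes \<open>0\<close> in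
          \<open>ennreal\<close>, so clusters at points of \<open>Y\<close> are empty, whereas a bad
          word belongs to the cluster at the image of its own bad code.\<close>
        have "B k = {}"
        proof (rule ccontr)
          assume "B k \<noteq> {}"
          then obtain v \<tau> where v: "v \<in> words I" "?level k v" "\<tau> \<in> cylinder I v" "\<pi> \<tau> \<in> Y"
            by (auto simp: B_def)
          obtain \<upsilon> n where "v = trunc \<upsilon> (Suc n)" using wordsE[OF v(1)] .
          then have "\<pi> \<tau> \<in> E v" using v(3) code_map_in[of \<tau> n] by (auto simp: mem_cylinder)
          then have "v \<in> cluster I E (\<pi> \<tau>) (exp (- real k))" using v by (auto simp: cluster_def)
          moreover have "emeasure (count_space UNIV) (cluster I E (\<pi> \<tau>) (exp (- real k))) = 0"
            using C[OF v(4) _ elim] False by (simp add: ennreal_neg)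
          ultimately show False by (auto simp: emeasure_count_space split: if_splits)
        qed
        then show ?thesis by (simp add: A_def)
      qed
    qed
  qed
  then have "AE \<sigma> in \<mu>. \<forall>\<^sub>F k in sequentially. \<sigma> \<in> space \<mu> - A k"
    using A_sets by (intro borel_cantelli_AE1) (auto simp: emeasure_eq_measure)
  then show ?thesis
  proof (rule AE_mp, intro AE_I2 impI)
    fix \<sigma> assume \<sigma>: "\<sigma> \<in> space \<mu>" and Y: "\<pi> \<sigma> \<in> Y" and "\<forall>\<^sub>F k in sequentially. \<sigma> \<in> space \<mu> - A k"
    from this(3) show "\<forall>\<^sub>F k in sequentially. \<forall>n.
           ediam (E (trunc \<sigma> (Suc n))) \<le> ennreal (exp (- real k)) \<and>
           ennreal (exp (- real k)) < ediam (E (trunc \<sigma> n)) \<longrightarrow>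
           measure \<nu> (cball (\<pi> \<sigma>) (exp (- (real k + 1))))
             \<le> exp (\<epsilon> * real k) * measure \<mu> (cyl \<sigma> (Suc n))"
    proof eventually_elim
      case (elim k)
      show ?case
      proof (intro allI impI)
        fix n
        assume level: "ediam (E (trunc \<sigma> (Suc n))) \<le> ennreal (exp (- real k)) \<and>
           ennreal (exp (- real k)) < ediam (E (trunc \<sigma> n))"
        have "\<sigma> \<in> seqs I" using \<sigma> by simp
        then have cyl: "\<sigma> \<in> cyl \<sigma> (Suc n)" and w: "trunc \<sigma> (Suc n) \<in> words I"
          by (simp_all add: mem_cylinder trunc_in_words)
        then have "trunc \<sigma> (Suc n) \<notin> B k" using elim by (auto simp: A_def)
        \<comment> \<open>Were the inequality false, \<open>\<sigma>\<close> itself would be a bad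
          code for this prefix.\<close>
        then show "measure \<nu> (cball (\<pi> \<sigma>) (exp (- (real k + 1))))
             \<le> exp (\<epsilon> * real k) * measure \<mu> (cyl \<sigma> (Suc n))"
          using level cyl w Y unfolding B_def by (auto simp: not_less)
      qed
    qed
  qed
qed

end

section \<open>Local dimensions\<close>

text \<open>The substitution \<open>r = exp (- t)\<close> turns limits in the radius into limits of
  the profile \<open>G\<close> at infinity.\<close>

lemma at_right_0_eq_filtermap: "at_right (0::real) = filtermap (\<lambda>t. exp (- t)) at_top"
proof (rule filtermap_fun_inverse[symmetric, where g = "\<lambda>x. - ln x"])
  show "filterlim (\<lambda>x::real. - ln x) at_top (at_right 0)"
    using ln_at_0 by (simp add: filterlim_uminus_at_top)
  have "((\<lambda>t::real. exp (- t)) \<longlongrightarrow> 0) at_top"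
    by (intro filterlim_compose[OF exp_at_bot] filterlim_uminus_at_bot_at_top)
  then show "filterlim (\<lambda>t::real. exp (- t)) (at_right 0) at_top"
    by (simp add: filterlim_at)
  show "\<forall>\<^sub>F x::real in at_right 0. exp (- (- ln x)) = x"
    by (auto simp: eventually_at_right_field intro: exI[of _ 1])
qed

lemma elog_ennreal: "0 < r \<Longrightarrow> elog (ennreal r) = ereal (ln r)"
  by (simp add: elog_def)

lemma (in finite_measure) elog_emeasure:
  "0 < measure M A \<Longrightarrow> elog (emeasure M A) = ereal (ln (measure M A))"
  by (simp add: emeasure_eq_measure elog_ennreal)

lemma ball_quotient:
  fixes M :: "'b::metric_space measure"
  assumes M: "finite_measure M" and pos: "\<And>r. 0 < r \<Longrightarrow> 0 < measure M (cball x r)"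
  shows "\<forall>\<^sub>F t in at_top. elog (emeasure M (cball x (exp (- t)))) / elog (ennreal (exp (- t)))
           = ereal (- ln (measure M (cball x (exp (- t)))) / t)"
  using eventually_gt_at_top[of 0]
proof eventually_elim
  case (elim t)
  then show ?case
    using finite_measure.elog_emeasure[OF M pos[of "exp (- t)"]] elog_ennreal[of "exp (- t)"] by simp
qed

lemma inj_exp_uminus: "inj (\<lambda>t::real. exp (- t))"
  by (auto simp: inj_def)

lemma lower_local_dim_eq:
  fixes M :: "'b::metric_space measure"
  assumes "finite_measure M" and "\<And>r. 0 < r \<Longrightarrow> 0 < measure M (cball x r)"
  shows "lower_local_dim M x = Liminf at_top (\<lambda>t. ereal (- ln (measure M (cball x (exp (- t)))) / t))"
  unfolding lower_local_dim_def at_right_0_eq_filtermap Liminf_filtermap_eq[OF inj_exp_uminus]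
  by (rule Liminf_eq[OF ball_quotient[OF assms]])

lemma upper_local_dim_eq:
  fixes M :: "'b::metric_space measure"
  assumes "finite_measure M" and "\<And>r. 0 < r \<Longrightarrow> 0 < measure M (cball x r)"
  shows "upper_local_dim M x = Limsup at_top (\<lambda>t. ereal (- ln (measure M (cball x (exp (- t)))) / t))"
  unfolding upper_local_dim_def at_right_0_eq_filtermap Limsup_filtermap_eq[OF inj_exp_uminus]
  by (rule Limsup_eq[OF ball_quotient[OF assms]])

section \<open>Almost sure properties of codes and the resulting local dimensions\<close>

context moran_coding
begin

text \<open>For \<open>\<sigma> \<in> seqs I\<close> at most one \<open>n\<close> satisfies the
  premise: the one where the diameter first drops to \<open>exp (- k)\<close>.\<close>

abbreviation "ball_bound \<sigma> \<epsilon> k \<equiv> (\<forall>n.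
  ediam (E (trunc \<sigma> (Suc n))) \<le> ennreal (exp (- real k)) \<and>
  ennreal (exp (- real k)) < ediam (E (trunc \<sigma> n)) \<longrightarrow>
  measure \<nu> (cball (\<pi> \<sigma>) (exp (- (real k + 1)))) \<le> exp (\<epsilon> * real k) * measure \<mu> (cyl \<sigma> (Suc n)))"

text \<open>Countably many sets \<open>Y j\<close> with uniform clustering exhaust the limit set,
  and it suffices to treat \<open>\<epsilon>\<close> of the form \<open>1 / (i + 1)\<close>, so
  countably many null sets are discarded.\<close>

lemma ball_bound_AE: "AE \<sigma> in \<mu>. \<forall>\<epsilon>>0. \<forall>\<^sub>F k in sequentially. ball_bound \<sigma> \<epsilon> k"
proof -
  define S where "S = (SUP x\<in>limit_set I E.
    Limsup (at_right 0) (\<lambda>r. emeasure (count_space UNIV) (cluster I E x r)))"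
  have "S < top" using clustering by (simp add: S_def finite_clustering_def infinity_ennreal_def)
  then obtain s where s: "S = ennreal s" "0 \<le> s" by (cases S) auto
  \<comment> \<open>An upper limit at most \<open>s\<close> eventually bounds the counts only by
    numbers larger than \<open>s\<close>, hence \<open>s + 1\<close>; the index \<open>j\<close>
    records the radius below which the bound holds.\<close>
  define Y where "Y j = {y. \<forall>r. 0 < r \<and> r < inverse (real (Suc j)) \<longrightarrow>
    emeasure (count_space UNIV) (cluster I E y r) \<le> ennreal (s + 1)}" for j
  have Y: "\<exists>j. y \<in> Y j" if "y \<in> limit_set I E" for y
  proof -
    have "Limsup (at_right 0) (\<lambda>r. emeasure (count_space UNIV) (cluster I E y r)) \<le> S"
      unfolding S_def using that by (rule SUP_upper)
    also have "\<dots> < ennreal (s + 1)" using s by (simp add: ennreal_less_iff)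
    finally obtain b where b: "b > 0"
      "\<And>r. 0 < r \<Longrightarrow> r < b \<Longrightarrow> emeasure (count_space UNIV) (cluster I E y r) < ennreal (s + 1)"
      by (auto dest!: Limsup_lessD simp: eventually_at_right_field)
    obtain j where "inverse (real (Suc j)) < b" using reals_Archimedean[OF b(1)] by blast
    then have "y \<in> Y j" unfolding Y_def using b(2) by (auto intro!: less_imp_le)
    then show ?thesis ..
  qed
  have "AE \<sigma> in \<mu>. \<forall>i j. \<pi> \<sigma> \<in> Y j \<longrightarrow>
      (\<forall>\<^sub>F k in sequentially. ball_bound \<sigma> (inverse (real (Suc i))) k)"
    unfolding AE_all_countable
  proof (intro allI)
    fix i j :: nat
    show "AE \<sigma> in \<mu>. \<pi> \<sigma> \<in> Y j \<longrightarrow> (\<forall>\<^sub>F k in sequentially. ball_bound \<sigma> (inverse (real (Suc i))) k)"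
      by (rule ball_bound_AE_on[where \<rho> = "inverse (real (Suc j))" and C = "s + 1"])
        (auto simp: Y_def)
  qed
  then show ?thesis
  proof (rule AE_mp, intro AE_I2 impI allI)
    fix \<sigma> and \<epsilon> :: real
    assume \<sigma>: "\<sigma> \<in> space \<mu>" and \<epsilon>: "\<epsilon> > 0"
      and all: "\<forall>i j. \<pi> \<sigma> \<in> Y j \<longrightarrow>
        (\<forall>\<^sub>F k in sequentially. ball_bound \<sigma> (inverse (real (Suc i))) k)"
    obtain j where "\<pi> \<sigma> \<in> Y j" using Y[OF code_map_limit_set] \<sigma> by auto
    moreover obtain i where i: "inverse (real (Suc i)) < \<epsilon>" using reals_Archimedean[OF \<epsilon>] by blast
    ultimately have "\<forall>\<^sub>F k in sequentially. ball_bound \<sigma> (inverse (real (Suc i))) k"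
      using all by blast
    then show "\<forall>\<^sub>F k in sequentially. ball_bound \<sigma> \<epsilon> k"
    proof eventually_elim
      case (elim k)
      have "exp (inverse (real (Suc i)) * real k) * measure \<mu> A \<le> exp (\<epsilon> * real k) * measure \<mu> A" for A
        using i by (intro mult_right_mono) (auto intro!: mult_right_mono)
      then show ?case using elim by (meson order_trans)
    qed
  qed
qed

text \<open>There are countably many words, so the null cylinders together form a null set.\<close>

lemma cylinder_pos_AE: "AE \<sigma> in \<mu>. \<forall>n. 0 < measure \<mu> (cyl \<sigma> (Suc n))"
proof -
  have "AE \<sigma> in \<mu>. \<forall>w\<in>words I. measure \<mu> (cylinder I w) = 0 \<longrightarrow> \<sigma> \<notin> cylinder I w"
    unfolding AE_ball_countable[OF countable_words]
  proof
    fix w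
    show "AE \<sigma> in \<mu>. measure \<mu> (cylinder I w) = 0 \<longrightarrow> \<sigma> \<notin> cylinder I w"
      by (cases "measure \<mu> (cylinder I w) = 0")
        (auto intro!: AE_not_in simp: null_sets_def emeasure_eq_measure)
  qed
  then show ?thesis
  proof (rule AE_mp, intro AE_I2 impI allI)
    fix \<sigma> n
    assume "\<sigma> \<in> space \<mu>" "\<forall>w\<in>words I. measure \<mu> (cylinder I w) = 0 \<longrightarrow> \<sigma> \<notin> cylinder I w"
    then have "measure \<mu> (cyl \<sigma> (Suc n)) \<noteq> 0"
      using trunc_in_words[of \<sigma> I n] by (auto simp: mem_cylinder)
    then show "0 < measure \<mu> (cyl \<sigma> (Suc n))" using measure_nonneg[of \<mu>] by (simp add: less_le)
  qed
qed

lemma measure_\<nu>_pos: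
  assumes "\<sigma> \<in> seqs I" "\<And>n. 0 < measure \<mu> (cyl \<sigma> (Suc n))" "0 < r"
  shows "0 < measure \<nu> (cball (\<pi> \<sigma>) r)"
proof -
  obtain n where "diam \<sigma> n < r"
    using order_tendstoD(2)[OF diam_tendsto[OF assms(1)] assms(3)] by (auto simp: eventually_sequentially)
  then show ?thesis
    using measure_cylinder_le[OF assms(1), of n r] assms(2)[of n] by linarith
qed

text \<open>Supplies the lower bound on \<open>G\<close> in \<open>growth_profile\<close>, with
  \<open>c\<close> the logarithm of the total mass.\<close>

lemma uminus_ln_measure_\<nu>_ge:
  assumes "0 < measure \<nu> A"
  shows "- ln (measure \<mu> (space \<mu>)) \<le> - ln (measure \<nu> A)"
proof -
  have "measure \<nu> A \<le> measure \<nu> (space \<nu>)"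
    by (rule finite_measure.bounded_measure[OF finite_\<nu>])
  also have "\<dots> = measure \<mu> (space \<mu>)" by (subst measure_distr) auto
  finally show ?thesis using assms by simp
qed

text \<open>Once a construction set is a single point, the symbolic quotient is \<open>0\<close> by
  the convention \<open>c / (-\<infinity>) = 0\<close>. On the other side
  \<open>\<pi> \<sigma>\<close> is an atom of \<open>\<nu>\<close>, so logarithms of ball masses
  stay bounded while \<open>t\<close> grows.\<close>

lemma local_dim_of_diam_0:
  assumes \<sigma>: "\<sigma> \<in> seqs I" and pos: "\<And>n. 0 < measure \<mu> (cyl \<sigma> (Suc n))" and N: "diam \<sigma> N = 0"
  shows "(\<lambda>n. elog (emeasure \<mu> (cyl \<sigma> n)) / elog (ediam (E (trunc \<sigma> n)))) \<longlonglongrightarrow> 0"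
    and "lower_local_dim \<nu> (\<pi> \<sigma>) = 0" and "upper_local_dim \<nu> (\<pi> \<sigma>) = 0"
proof -
  have "elog (emeasure \<mu> (cyl \<sigma> n)) / elog (ediam (E (trunc \<sigma> n))) = 0" if n: "n \<ge> Suc N" for n
  proof -
    obtain m where m: "n = Suc m" "m \<ge> N" using n by (cases n) auto
    then have "diam \<sigma> m = 0"
      using diam_antimono[OF \<sigma> m(2)] diam_nonneg[OF \<sigma>, of m] N by simp
    then show ?thesis using elog_emeasure[OF pos[of m]] ediam_Suc[OF \<sigma>, of m] m by (simp add: elog_def)
  qed
  then show "(\<lambda>n. elog (emeasure \<mu> (cyl \<sigma> n)) / elog (ediam (E (trunc \<sigma> n)))) \<longlonglongrightarrow> 0"
    by (intro tendsto_eventually) (auto simp: eventually_sequentially)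
  let ?G = "\<lambda>t. - ln (measure \<nu> (cball (\<pi> \<sigma>) (exp (- t))))"
  note ball_pos = measure_\<nu>_pos[OF \<sigma> pos]
  have upper: "?G t \<le> - ln (measure \<mu> (cyl \<sigma> (Suc N)))" for t
    using measure_cylinder_le[OF \<sigma>, of N "exp (- t)"] pos[of N] N by simp
  have vanish: "((\<lambda>t. a / t) \<longlongrightarrow> 0) at_top" for a :: real
    by (intro tendsto_divide_0[OF tendsto_const] filterlim_at_top_imp_at_infinity filterlim_ident)
  have "((\<lambda>t. ?G t / t) \<longlongrightarrow> 0) at_top"
  proof (rule tendsto_sandwich)
    show "\<forall>\<^sub>F t in at_top. - ln (measure \<mu> (space \<mu>)) / t \<le> ?G t / t"
      using eventually_gt_at_top[of 0]
      by eventually_elim (intro divide_right_mono uminus_ln_measure_\<nu>_ge ball_pos, auto)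
    show "\<forall>\<^sub>F t in at_top. ?G t / t \<le> - ln (measure \<mu> (cyl \<sigma> (Suc N))) / t"
      using eventually_gt_at_top[of 0] by eventually_elim (intro divide_right_mono upper, auto)
  qed (rule vanish)+
  then have lim: "((\<lambda>t. ereal (?G t / t)) \<longlongrightarrow> 0) at_top"
    by (simp add: zero_ereal_def)
  have "lower_local_dim \<nu> (\<pi> \<sigma>) = Liminf at_top (\<lambda>t. ereal (?G t / t))"
    by (intro lower_local_dim_eq finite_\<nu> ball_pos)
  also have "\<dots> = 0" by (rule lim_imp_Liminf[OF _ lim]) simp
  finally show "lower_local_dim \<nu> (\<pi> \<sigma>) = 0" .
  have "upper_local_dim \<nu> (\<pi> \<sigma>) = Limsup at_top (\<lambda>t. ereal (?G t / t))"
    by (intro upper_local_dim_eq finite_\<nu> ball_pos)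
  also have "\<dots> = 0" by (rule lim_imp_Limsup[OF _ lim]) simp
  finally show "upper_local_dim \<nu> (\<pi> \<sigma>) = 0" .
qed

text \<open>\<open>Min\<close> bounds the members of finite sets only; here the children of a word
  are indexed by the finite alphabet \<open>I n\<close>.\<close>

lemma min_child_diam_le:
  assumes "\<sigma> \<in> seqs I"
  shows "min_child_diam I E \<sigma> n \<le> ediam (E (trunc \<sigma> (Suc n)))"
  unfolding min_child_diam_def
proof (rule Min_le)
  have "{ediam (E w) | w. w \<in> words_of_length I (Suc n) \<and> butlast w = trunc \<sigma> n}
      \<subseteq> (\<lambda>i. ediam (E (trunc \<sigma> n @ [i]))) ` I n"
  proof safe
    fix w assume w: "w \<in> words_of_length I (Suc n)" "butlast w = trunc \<sigma> n"
    then obtain \<tau> where "\<tau> \<in> seqs I" "w = trunc \<tau> (Suc n)" by (auto simp: words_of_length_def)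
    then have "w = trunc \<sigma> n @ [\<tau> n]" "\<tau> n \<in> I n"
      using w(2) by (auto simp: trunc_def seqs_def PiE_iff)
    then show "ediam (E w) \<in> (\<lambda>i. ediam (E (trunc \<sigma> n @ [i]))) ` I n" by auto
  qed
  moreover have "finite (I n)" using moran by (auto simp: moran_construction_def)
  ultimately show "finite {ediam (E w) | w. w \<in> words_of_length I (Suc n) \<and> butlast w = trunc \<sigma> n}"
    by (blast intro: finite_subset)
  show "ediam (E (trunc \<sigma> (Suc n)))
      \<in> {ediam (E w) | w. w \<in> words_of_length I (Suc n) \<and> butlast w = trunc \<sigma> n}"
    using assms by (auto simp: words_of_length_def intro!: exI[of _ "trunc \<sigma> (Suc n)"])
qed

text \<open>The least child diameter \<open>c\<close> is at most the diameter of the child along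
  \<open>\<sigma>\<close>. As \<open>ln c < 0\<close>, the lower half of (M5) becomes
  \<open>ln (diam \<sigma> n) < (1 - \<epsilon>) * ln c\<close>, and \<open>c\<close> may be
  enlarged to that diameter.\<close>

lemma M5_diam:
  assumes M5: "M5 I E" and \<sigma>: "\<sigma> \<in> seqs I" and pos: "\<And>n. 0 < diam \<sigma> n"
    and \<epsilon>: "0 < \<epsilon>" "\<epsilon> < 1"
  shows "\<forall>\<^sub>F n in sequentially. (1 - \<epsilon>) * - ln (diam \<sigma> (Suc n)) \<le> - ln (diam \<sigma> n)"
proof -
  have "\<forall>\<^sub>F n in sequentially.
      \<bar>elog (ediam (E (trunc \<sigma> n))) / elog (min_child_diam I E \<sigma> n) - 1\<bar> < ereal \<epsilon>"
    using M5 \<epsilon>(1) \<sigma> unfolding M5_def by (fastforce elim: eventually_mono)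
  \<comment> \<open>\<open>diam \<sigma> n\<close> belongs to the prefix of length
    \<open>Suc n\<close>, so (M5) is read one level later.\<close>
  then have "\<forall>\<^sub>F n in sequentially.
      \<bar>elog (ediam (E (trunc \<sigma> (Suc n)))) / elog (min_child_diam I E \<sigma> (Suc n)) - 1\<bar> < ereal \<epsilon>"
    by (rule eventually_sequentially_Suc[THEN iffD2])
  moreover have "\<forall>\<^sub>F n in sequentially. diam \<sigma> n < 1"
    using order_tendstoD(2)[OF diam_tendsto[OF \<sigma>], of 1] by simp
  ultimately show ?thesis
  proof eventually_elim
    case (elim n)
    let ?c = "min_child_diam I E \<sigma> (Suc n)"
    have "?c \<le> ennreal (diam \<sigma> (Suc n))"
      using min_child_diam_le[OF \<sigma>, of "Suc n"] ediam_Suc[OF \<sigma>, of "Suc n"] by simp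
    then obtain c where c: "?c = ennreal c" "0 \<le> c" "c \<le> diam \<sigma> (Suc n)"
      using pos[of "Suc n"] by (cases ?c) (auto simp: top_unique)
    have num: "elog (ediam (E (trunc \<sigma> (Suc n)))) = ereal (ln (diam \<sigma> n))"
      using elog_ennreal[OF pos[of n]] ediam_Suc[OF \<sigma>] by simp
    \<comment> \<open>For \<open>c = 0\<close> the quotient would be \<open>0\<close> by convention,
      at distance 1 from its limit, while \<open>\<epsilon> < 1\<close>.\<close>
    have "c \<noteq> 0"
    proof
      assume "c = 0"
      then have "elog (ediam (E (trunc \<sigma> (Suc n)))) / elog ?c = 0" using num c by (simp add: elog_def)
      then show False using elim(1) \<epsilon> by (simp add: one_ereal_def)
    qed
    then have c0: "0 < c" using c by simp
    have "c < 1" using c(3) elim(2) diam_antimono[OF \<sigma>, of n "Suc n"] by simp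
    then have ln: "ln c < 0" using c0 by simp
    have "\<bar>ln (diam \<sigma> n) / ln c - 1\<bar> < \<epsilon>"
      using elim(1) num elog_ennreal[OF c0] c(1) ln by (simp add: one_ereal_def)
    then have "1 - \<epsilon> < ln (diam \<sigma> n) / ln c" by linarith
    then have "ln (diam \<sigma> n) < (1 - \<epsilon>) * ln c" using ln by (simp add: less_divide_eq)
    also have "\<dots> \<le> (1 - \<epsilon>) * ln (diam \<sigma> (Suc n))"
      using \<epsilon> c(3) c0 by (intro mult_left_mono) auto
    finally show ?case by simp
  qed
qed

text \<open>Eventually \<open>diam \<sigma> n < 1\<close>, so the denominator is nonzero;
  \<open>ereal\<close> and \<open>real\<close> division treat a zero denominator
  differently.\<close>

lemma symbolic_quotient:
  assumes \<sigma>: "\<sigma> \<in> seqs I" and pos: "\<And>n. 0 < measure \<mu> (cyl \<sigma> (Suc n))"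
    and diam: "\<And>n. 0 < diam \<sigma> n"
  shows "\<forall>\<^sub>F n in sequentially.
    elog (emeasure \<mu> (cyl \<sigma> (n + 1))) / elog (ediam (E (trunc \<sigma> (n + 1))))
      = ereal (- ln (measure \<mu> (cyl \<sigma> (Suc n))) / - ln (diam \<sigma> n))"
proof -
  have "\<forall>\<^sub>F n in sequentially. diam \<sigma> n < 1"
    using order_tendstoD(2)[OF diam_tendsto[OF \<sigma>], of 1] by simp
  then show ?thesis
  proof eventually_elim
    case (elim n)
    then have "ln (diam \<sigma> n) < 0" using diam by simp
    then show ?case
      using elog_emeasure[OF pos[of n]] elog_ennreal[OF diam[of n]] ediam_Suc[OF \<sigma>, of n] by simp
  qed
qed

text \<open>If some diameter along \<open>\<sigma>\<close> vanishes, all quantities are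
  \<open>0\<close>; otherwise the logarithms are finite and form a
  \<open>growth_profile\<close>.\<close>

lemma local_dims:
  assumes \<sigma>: "\<sigma> \<in> seqs I" and pos: "\<And>n. 0 < measure \<mu> (cyl \<sigma> (Suc n))"
    and bound: "\<And>\<epsilon>. \<epsilon> > 0 \<Longrightarrow> \<forall>\<^sub>F k in sequentially. ball_bound \<sigma> \<epsilon> k"
  defines "q \<equiv> \<lambda>n. elog (emeasure \<mu> (cyl \<sigma> n)) / elog (ediam (E (trunc \<sigma> n)))"
  shows "lower_local_dim \<nu> (\<pi> \<sigma>) = liminf q" "limsup q \<le> upper_local_dim \<nu> (\<pi> \<sigma>)"
    and "M5 I E \<Longrightarrow> upper_local_dim \<nu> (\<pi> \<sigma>) = limsup q"
proof -
  have "lower_local_dim \<nu> (\<pi> \<sigma>) = liminf q \<and> limsup q \<le> upper_local_dim \<nu> (\<pi> \<sigma>) \<and>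
    (M5 I E \<longrightarrow> upper_local_dim \<nu> (\<pi> \<sigma>) = limsup q)"
  proof (cases "\<exists>N. diam \<sigma> N = 0")
    case True
    then obtain N where N: "diam \<sigma> N = 0" ..
    note * = local_dim_of_diam_0[OF \<sigma> pos N]
    have "liminf q = 0" "limsup q = 0"
      unfolding q_def using *(1) by (simp_all add: lim_imp_Liminf lim_imp_Limsup)
    then show ?thesis using *(2,3) by simp
  next
    case False
    then have diam: "0 < diam \<sigma> n" for n using diam_nonneg[OF \<sigma>, of n] by (simp add: less_le)
    interpret N: finite_measure \<nu> by (rule finite_\<nu>)
    note ball_pos = measure_\<nu>_pos[OF \<sigma> pos]
    let ?h = "\<lambda>n. - ln (measure \<mu> (cyl \<sigma> (Suc n)))"
    let ?l = "\<lambda>n. - ln (diam \<sigma> n)"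
    let ?G = "\<lambda>t. - ln (measure \<nu> (cball (\<pi> \<sigma>) (exp (- t))))"
    have le_l: "diam \<sigma> n \<le> exp (- t) \<longleftrightarrow> t \<le> ?l n" for n t
      using exp_le_cancel_iff[of "ln (diam \<sigma> n)" "- t"] exp_ln[OF diam[of n]] by auto
    interpret growth_profile ?l ?h ?G "ln (measure \<mu> (space \<mu>))"
    proof
      show "mono ?l" using diam diam_antimono[OF \<sigma>] by (auto intro!: monoI)
      show "mono ?h"
      proof (rule monoI)
        fix m n :: nat assume "m \<le> n"
        have "cyl \<sigma> (Suc n) \<subseteq> cyl \<sigma> (Suc m)"
          using \<open>m \<le> n\<close> by (auto simp: mem_cylinder trunc_eq_iff)
        then show "?h m \<le> ?h n" using pos by (simp add: finite_measure_mono)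
      qed
      show "mono ?G"
      proof (rule monoI)
        fix s t :: real assume "s \<le> t"
        then have "measure \<nu> (cball (\<pi> \<sigma>) (exp (- t))) \<le> measure \<nu> (cball (\<pi> \<sigma>) (exp (- s)))"
          by (intro N.finite_measure_mono subset_cball) auto
        then show "?G s \<le> ?G t" using ball_pos by simp
      qed
      show "filterlim ?l at_top sequentially"
      proof -
        have "filterlim (diam \<sigma>) (at_right 0) sequentially"
          using diam_tendsto[OF \<sigma>] diam by (auto simp: filterlim_at less_imp_neq[THEN not_sym])
        then show ?thesis
          unfolding filterlim_uminus_at_top by (simp add: filterlim_compose[OF ln_at_0])
      qed
      show "- ln (measure \<mu> (space \<mu>)) \<le> ?G t" for t
        by (intro uminus_ln_measure_\<nu>_ge ball_pos) simp
      show "?G t \<le> ?h n" if "t \<le> ?l n" for t n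
        using measure_cylinder_le[OF \<sigma>, of n "exp (- t)"] pos[of n] that le_l[of n t] by simp
      show "\<forall>\<^sub>F k in sequentially. \<forall>n. ?l n < real k \<and> real k \<le> ?l (Suc n) \<longrightarrow>
          ?h (Suc n) - \<epsilon> * real k \<le> ?G (real k + 1)" if "\<epsilon> > 0" for \<epsilon>
        using bound[OF that]
      proof eventually_elim
        case (elim k)
        show ?case
        proof (intro allI impI)
          fix n assume n: "?l n < real k \<and> real k \<le> ?l (Suc n)"
          let ?b = "measure \<nu> (cball (\<pi> \<sigma>) (exp (- (real k + 1))))"
          let ?m = "measure \<mu> (cyl \<sigma> (Suc (Suc n)))"
          \<comment> \<open>\<open>?l n\<close> refers to the prefix of length \<open>Suc n\<close>,
            so the prefix cut at scale \<open>exp (- k)\<close> has length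
            \<open>Suc (Suc n)\<close>, and \<open>ball_bound\<close> is used at
            \<open>Suc n\<close>.\<close>
          have "?b \<le> exp (\<epsilon> * real k) * ?m"
            using elim[rule_format, of "Suc n"] n le_l[of n "real k"] le_l[of "Suc n" "real k"]
              ediam_Suc[OF \<sigma>, of n] ediam_Suc[OF \<sigma>, of "Suc n"]
            by (auto simp: ennreal_less_iff intro!: ennreal_leI)
          moreover have "0 < ?b" by (intro ball_pos) simp
          ultimately have "ln ?b \<le> ln (exp (\<epsilon> * real k) * ?m)" by simp
          also have "\<dots> = \<epsilon> * real k + ln ?m" using pos[of "Suc n"] by (simp add: ln_mult)
          finally show "?h (Suc n) - \<epsilon> * real k \<le> ?G (real k + 1)" by simp
        qed
      qed
    qed
    \<comment> \<open>The shift by one drops the term of the empty word, whose set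
      \<open>E []\<close> is arbitrary.\<close>
    have liminf: "liminf q = liminf (\<lambda>n. ereal (?h n / ?l n))"
      unfolding q_def by (subst liminf_shift[symmetric], rule Liminf_eq, rule symbolic_quotient[OF \<sigma> pos diam])
    have limsup: "limsup q = limsup (\<lambda>n. ereal (?h n / ?l n))"
      unfolding q_def by (subst limsup_shift[symmetric], rule Limsup_eq, rule symbolic_quotient[OF \<sigma> pos diam])
    have lower: "lower_local_dim \<nu> (\<pi> \<sigma>) = Liminf at_top (\<lambda>t. ereal (?G t / t))"
      by (intro lower_local_dim_eq finite_\<nu> ball_pos)
    have upper: "upper_local_dim \<nu> (\<pi> \<sigma>) = Limsup at_top (\<lambda>t. ereal (?G t / t))"
      by (intro upper_local_dim_eq finite_\<nu> ball_pos)
    show ?thesis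
      unfolding lower upper liminf limsup
      using Liminf_G_le liminf_le_Liminf_G limsup_le_Limsup_G Limsup_G_le M5_diam[OF _ \<sigma> diam]
      by (blast intro: antisym)
  qed
  then show "lower_local_dim \<nu> (\<pi> \<sigma>) = liminf q" "limsup q \<le> upper_local_dim \<nu> (\<pi> \<sigma>)"
    and "M5 I E \<Longrightarrow> upper_local_dim \<nu> (\<pi> \<sigma>) = limsup q" by auto
qed

end

theorem theorem3p5:
  fixes I :: "nat \<Rightarrow> 'i set"
    and E :: "'i list \<Rightarrow> 'a::polish_space set"
    and \<mu> :: "(nat \<Rightarrow> 'i) measure"
  assumes "moran_construction I E"
    and "finite_clustering I E"
    and "finite_measure \<mu>"
    and "borel_regular (seqs_topology I) \<mu>"
  shows "(AE \<sigma> in \<mu>.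
            lower_local_dim (distr \<mu> borel (code_map E)) (code_map E \<sigma>)
              = liminf (\<lambda>n. elog (emeasure \<mu> (cylinder I (trunc \<sigma> n)))
                              / elog (ediam (E (trunc \<sigma> n)))) \<and>
            upper_local_dim (distr \<mu> borel (code_map E)) (code_map E \<sigma>)
              \<ge> limsup (\<lambda>n. elog (emeasure \<mu> (cylinder I (trunc \<sigma> n)))
                              / elog (ediam (E (trunc \<sigma> n))))) \<and>
         (M5 I E \<longrightarrow>
            (AE \<sigma> in \<mu>.
               upper_local_dim (distr \<mu> borel (code_map E)) (code_map E \<sigma>)
                 = limsup (\<lambda>n. elog (emeasure \<mu> (cylinder I (trunc \<sigma> n)))
                                 / elog (ediam (E (trunc \<sigma> n))))))"
proof -
  interpret moran_coding \<mu> I E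
    using assms by (simp add: moran_coding_def moran_coding_axioms_def)
  \<comment> \<open>One set of codes of full measure serves all three claims.\<close>
  have good: "AE \<sigma> in \<mu>. \<sigma> \<in> seqs I \<and> (\<forall>n. 0 < measure \<mu> (cyl \<sigma> (Suc n))) \<and>
      (\<forall>\<epsilon>>0. \<forall>\<^sub>F k in sequentially. ball_bound \<sigma> \<epsilon> k)"
    using cylinder_pos_AE ball_bound_AE AE_space by eventually_elim simp
  show ?thesis
  proof (intro conjI impI)
    assume "M5 I E"
    from good show "AE \<sigma> in \<mu>. upper_local_dim \<nu> (\<pi> \<sigma>)
        = limsup (\<lambda>n. elog (emeasure \<mu> (cyl \<sigma> n)) / elog (ediam (E (trunc \<sigma> n))))"
      by (rule eventually_mono) (use local_dims(3)[OF _ _ _ \<open>M5 I E\<close>] in blast)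
  qed (use good in \<open>rule eventually_mono, use local_dims(1,2) in blast\<close>)
qed

end
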